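(* (Dirichlet principle.) Let $\lambda>0$ and $u\in\operatorname{dom}J$. Then $$\check{\mathcal E}_\lambda[Ju]=\inf\{\mathcal E_\lambda[v]:\ v\in\operatorname{dom}J,\ Jv=Ju\}.$$ Moreover, $\check{\mathcal E}_\lambda\le\check{\mathcal E}_\mu$ for $0<\lambda\le\mu$ (i.e. $\check{\mathcal E}_\lambda[\psi]\le\check{\mathcal E}_\mu[\psi]$ for all $\psi$ in the common domain $\operatorname{ran}J$).
   Context: Let $\mathcal H,\mathcal H_{\mathrm{aux}}$ be Hilbert spaces. Let $\mathcal E$ be a closed positive (i.e. symmetric, nonnegative) quadratic form with domain $\mathcal D\subseteq\mathcal H$; write $\mathcal E(\cdot,\cdot)$ for the associated sesquilinear form, $\mathcal E[u]:=\mathcal E(u,u)$, and $\mathcal E_\lambda[u]:=\mathcal E[u]+\lambda\|u\|^2$ for $\lambda>0$. Let $J\colon\operatorname{dom}J\subseteq\mathcal D\to\mathcal H_{\mathrm{aux}}$ be a linear operator with dense range which is closed as an operator from $(\mathcal D,\mathcal E_1^{1/2})$ to $\mathcal H_{\mathrm{aux}}$. For $\lambda>0$ let $P_\lambda$ be the $\mathcal E_\lambda$-orthogonal projection in the Hilbert space $(\mathcal D,\mathcal E_\lambda^{1/2})$ onto the $\mathcal E_\lambda$-orthogonal complement of $\ker J$. Define the quadratic form $\check{\mathcal E}_\lambda$ in $\mathcal H_{\mathrm{aux}}$ by $\operatorname{dom}\check{\mathcal E}_\lambda:=\operatorname{ran}J$, $\check{\mathcal E}_\lambda[Ju]:=\mathcal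 E_\lambda[P_\lambda u]$ for $u\in\operatorname{dom}J$. *)

theory Defs
  imports "HOL-Analysis.Analysis"
begin

(* The scalar fields: the axioms determine the field to be the reals or the complex numbers,
   with (complex) conjugation, so that real and complex Hilbert spaces are treated together. *)
class real_or_complex = real_normed_field +
  fixes conjg :: "'a \<Rightarrow> 'a"
    and re_part :: "'a \<Rightarrow> real"
  assumes conjg_add: "conjg (x + y) = conjg x + conjg y"
    and conjg_mult: "conjg (x * y) = conjg x * conjg y"
    and conjg_conjg: "conjg (conjg x) = x"
    and mult_conjg: "x * conjg x = (norm x)\<^sup>2 *\<^sub>R 1"
    and add_conjg: "x + conjg x = (2 * re_part x) *\<^sub>R 1"

instantiation real :: real_or_complex
begin
definition conjg_real :: "real \<Rightarrow> real" where "conjg_real x = x"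
definition re_part_real :: "real \<Rightarrow> real" where "re_part_real x = x"
instance
  by standard (simp_all add: conjg_real_def re_part_real_def power2_eq_square)
end

instantiation complex :: real_or_complex
begin
definition conjg_complex :: "complex \<Rightarrow> complex" where "conjg_complex = cnj"
definition re_part_complex :: "complex \<Rightarrow> real" where "re_part_complex = Re"
instance
proof
  fix x y :: complex
  show "x * conjg x = (norm x)\<^sup>2 *\<^sub>R 1"
    by (simp add: conjg_complex_def complex_norm_square [symmetric] scaleR_conv_of_real)
  show "x + conjg x = (2 * re_part x) *\<^sub>R 1"
    by (simp add: conjg_complex_def re_part_complex_def complex_add_cnj scaleR_conv_of_real)
qed (simp_all add: conjg_complex_def)
end

(* A Hilbert space over 'k, living on a complete real inner product space (which supplies
   the norm and the topology). Inner products are linear in the first argument. *)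
locale hilbert_space = vector_space smul
  for smul :: "'k::real_or_complex \<Rightarrow> 'h::{real_inner,complete_space} \<Rightarrow> 'h" +
  fixes ip :: "'h \<Rightarrow> 'h \<Rightarrow> 'k"
  assumes smul_of_real: "smul (of_real r) x = r *\<^sub>R x"
    and ip_add_left: "ip (x + y) z = ip x z + ip y z"
    and ip_smul_left: "ip (smul c x) y = c * ip x y"
    and ip_sym: "ip y x = conjg (ip x y)"
    and re_ip: "re_part (ip x y) = inner x y"

lemma hilbert_space_real:
  "hilbert_space (scaleR :: real \<Rightarrow> 'h::{real_inner,complete_space} \<Rightarrow> 'h) inner"
  by unfold_locales
    (simp_all add: algebra_simps inner_add_left conjg_real_def re_part_real_def inner_commute)

lemma hilbert_space_complex:
  "hilbert_space ((*) :: complex \<Rightarrow> complex \<Rightarrow> complex) (\<lambda>x y. x * cnj y)"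
  by unfold_locales
    (simp_all add: algebra_simps conjg_complex_def re_part_complex_def inner_complex_def
      scaleR_conv_of_real)

(* E u v is only meaningful for u and v in the domain D. *)
definition sesquilinear_on ::
  "('k::real_or_complex \<Rightarrow> 'h::ab_group_add \<Rightarrow> 'h) \<Rightarrow> 'h set \<Rightarrow> ('h \<Rightarrow> 'h \<Rightarrow> 'k) \<Rightarrow> bool" where
  "sesquilinear_on smul D E \<longleftrightarrow>
     (\<forall>u\<in>D. \<forall>v\<in>D. \<forall>w\<in>D. E (u + v) w = E u w + E v w \<and> E w (u + v) = E w u + E w v) \<and>
     (\<forall>c. \<forall>u\<in>D. \<forall>v\<in>D. E (smul c u) v = c * E u v \<and> E u (smul c v) = conjg c * E u v)"

definition qform :: "('h \<Rightarrow> 'h \<Rightarrow> 'k::real_or_complex) \<Rightarrow> 'h \<Rightarrow> real" where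
  "qform E u = re_part (E u u)"

definition positive_form ::
  "('k::real_or_complex \<Rightarrow> 'h::ab_group_add \<Rightarrow> 'h) \<Rightarrow> 'h set \<Rightarrow> ('h \<Rightarrow> 'h \<Rightarrow> 'k) \<Rightarrow> bool" where
  "positive_form smul D E \<longleftrightarrow>
     module.subspace smul D \<and> sesquilinear_on smul D E \<and>
     (\<forall>u\<in>D. \<forall>v\<in>D. E v u = conjg (E u v)) \<and>
     (\<forall>u\<in>D. 0 \<le> qform E u)"

(* Closedness in the sense of Kato: an E-Cauchy sequence of D that converges in the ambient
   Hilbert space has its limit in D and converges to it with respect to E. *)
definition closed_form :: "'h::real_normed_vector set \<Rightarrow> ('h \<Rightarrow> 'h \<Rightarrow> 'k::real_or_complex) \<Rightarrow> bool" where
  "closed_form D E \<longleftrightarrow>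
     (\<forall>s u. (\<forall>n. s n \<in> D) \<and> s \<longlonglongrightarrow> u \<and>
        (\<forall>e>0. \<exists>N. \<forall>m\<ge>N. \<forall>n\<ge>N. qform E (s m - s n) < e) \<longrightarrow>
        u \<in> D \<and> (\<lambda>n. qform E (s n - u)) \<longlonglongrightarrow> 0)"

definition shifted_form ::
  "('h \<Rightarrow> 'h \<Rightarrow> 'k::real_or_complex) \<Rightarrow> ('h \<Rightarrow> 'h \<Rightarrow> 'k) \<Rightarrow> real \<Rightarrow> 'h \<Rightarrow> 'h \<Rightarrow> 'k" where
  "shifted_form ip E l u v = E u v + of_real l * ip u v"

(* Operators are total functions J with a domain A; the values of J outside A are irrelevant. *)
definition linear_operator_on ::
  "('k::real_or_complex \<Rightarrow> 'h::ab_group_add \<Rightarrow> 'h) \<Rightarrow> ('k \<Rightarrow> 'g::ab_group_add \<Rightarrow> 'g) \<Rightarrow>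
   'h set \<Rightarrow> ('h \<Rightarrow> 'g) \<Rightarrow> bool" where
  "linear_operator_on smul smul' A J \<longleftrightarrow>
     module.subspace smul A \<and>
     (\<forall>u\<in>A. \<forall>v\<in>A. J (u + v) = J u + J v) \<and>
     (\<forall>c. \<forall>u\<in>A. J (smul c u) = smul' c (J u))"

(* Closedness of J as an operator from D, normed by the square root of F[u], to 'g. *)
definition closed_operator ::
  "'h::ab_group_add set \<Rightarrow> ('h \<Rightarrow> 'h \<Rightarrow> 'k::real_or_complex) \<Rightarrow> 'h set \<Rightarrow>
   ('h \<Rightarrow> 'g::real_normed_vector) \<Rightarrow> bool" where
  "closed_operator D F A J \<longleftrightarrow>
     (\<forall>s u w. (\<forall>n. s n \<in> A) \<and> u \<in> D \<and>
        (\<lambda>n. sqrt (qform F (s n - u))) \<longlonglongrightarrow> 0 \<and> (\<lambda>n. J (s n)) \<longlonglongrightarrow> w \<longrightarrow>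
        u \<in> A \<and> J u = w)"

definition op_kernel :: "'h set \<Rightarrow> ('h \<Rightarrow> 'g::zero) \<Rightarrow> 'h set" where
  "op_kernel A J = {u \<in> A. J u = 0}"

definition orth_compl :: "'h set \<Rightarrow> ('h \<Rightarrow> 'h \<Rightarrow> 'k::real_or_complex) \<Rightarrow> 'h set \<Rightarrow> 'h set" where
  "orth_compl D F S = {w \<in> D. \<forall>s\<in>S. F w s = 0}"

definition orth_proj ::
  "('h::ab_group_add \<Rightarrow> 'h \<Rightarrow> 'k::real_or_complex) \<Rightarrow> 'h set \<Rightarrow> 'h \<Rightarrow> 'h" where
  "orth_proj F M u = (THE w. w \<in> M \<and> (\<forall>m\<in>M. F (u - w) m = 0))"

definition proj_P ::
  "('h::ab_group_add \<Rightarrow> 'h \<Rightarrow> 'k::real_or_complex) \<Rightarrow> 'h set \<Rightarrow> ('h \<Rightarrow> 'h \<Rightarrow> 'k) \<Rightarrow>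
   'h set \<Rightarrow> ('h \<Rightarrow> 'g::zero) \<Rightarrow> real \<Rightarrow> 'h \<Rightarrow> 'h" where
  "proj_P ip D E A J l =
     orth_proj (shifted_form ip E l) (orth_compl D (shifted_form ip E l) (op_kernel A J))"

(* The form on ran J. The definite description pins down a value only if the right-hand side
   does not depend on the preimage u of psi; values outside J ` A are irrelevant. *)
definition check_form ::
  "('h::ab_group_add \<Rightarrow> 'h \<Rightarrow> 'k::real_or_complex) \<Rightarrow> 'h set \<Rightarrow> ('h \<Rightarrow> 'h \<Rightarrow> 'k) \<Rightarrow>
   'h set \<Rightarrow> ('h \<Rightarrow> 'g::zero) \<Rightarrow> real \<Rightarrow> 'g \<Rightarrow> real" where
  "check_form ip D E A J l \<psi> =
     (THE e. \<exists>u\<in>A. J u = \<psi> \<and> e = qform (shifted_form ip E l) (proj_P ip D E A J l u))"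

end

theory Submission
  imports Defs
begin

text \<open>
  The kernel of \<open>J\<close> is closed in the Hilbert space \<open>(D, \<E>\<^sub>\<lambda>)\<close>, so each \<open>u\<close> in the domain of \<open>J\<close>
  splits as \<open>u = k + P\<^sub>\<lambda> u\<close> with \<open>k\<close> in the kernel and \<open>P\<^sub>\<lambda> u\<close> orthogonal to it. Hence
  \<open>P\<^sub>\<lambda> u\<close> is itself a competitor in the variational problem, \<open>J (P\<^sub>\<lambda> u) = J u\<close>, and every other
  competitor \<open>v\<close> differs from it by an element of the kernel, so that by Pythagoras
  \<open>\<E>\<^sub>\<lambda>[v] = \<E>\<^sub>\<lambda>[P\<^sub>\<lambda> u] + \<E>\<^sub>\<lambda>[v - P\<^sub>\<lambda> u] \<ge> \<E>\<^sub>\<lambda>[P\<^sub>\<lambda> u]\<close>. Thus the infimum is a minimum, attained at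
  \<open>P\<^sub>\<lambda> u\<close>; in particular \<open>\<E>\<^sub>\<lambda>[P\<^sub>\<lambda> u]\<close> depends on \<open>J u\<close> only. Monotonicity in \<open>\<lambda>\<close> follows by
  inserting the minimizer for the larger parameter into the problem for the smaller one.

  The only analytic step is the splitting of \<open>u\<close> (lemma \<open>ex_orthogonal_approximant\<close>). It is proved
  for a real nonnegative symmetric bilinear form by the classical minimizing-sequence argument and
  is applied to the real part of \<open>\<E>\<^sub>\<lambda>\<close>; on a subspace over the full scalar field, orthogonality for
  the real part is the same as orthogonality.
\<close>

section \<open>Orthogonal approximation for nonnegative bilinear forms\<close>

lemma nonneg_quadratic_imp_discriminant_le:
  fixes a b c :: real
  assumes "0 \<le> c" and nonneg: "\<And>t. 0 \<le> a - 2 * t * b + t\<^sup>2 * c"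
  shows "b\<^sup>2 \<le> a * c"
proof (cases "c = 0")
  case True
  have "b = 0"
  proof (rule ccontr)
    assume "b \<noteq> 0"
    then show False
      using nonneg[of "(a + 1) / (2 * b)"] True by simp
  qed
  then show ?thesis using True by simp
next
  case False
  have "0 \<le> (a - 2 * (b / c) * b + (b / c)\<^sup>2 * c) * c"
    using nonneg[of "b / c"] assms(1) by (rule mult_nonneg_nonneg)
  also have "\<dots> = a * c - b\<^sup>2"
    using False by (simp add: field_simps power2_eq_square)
  finally show ?thesis by simp
qed

lemma null_sequence_if_square_le:
  fixes f g :: "nat \<Rightarrow> real"
  assumes "\<And>n. (f n)\<^sup>2 \<le> g n" "g \<longlonglongrightarrow> 0"
  shows "f \<longlonglongrightarrow> 0"
proof -
  have "(\<lambda>n. (f n)\<^sup>2) \<longlonglongrightarrow> 0"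
    using assms(1) by (intro Lim_null_comparison[OF always_eventually assms(2)]) simp
  then show ?thesis by simp
qed

locale nonneg_form =
  fixes V :: "'a::real_vector set" and B :: "'a \<Rightarrow> 'a \<Rightarrow> real"
  assumes subspace_V: "subspace V"
    and sym: "u \<in> V \<Longrightarrow> v \<in> V \<Longrightarrow> B u v = B v u"
    and add_left: "u \<in> V \<Longrightarrow> v \<in> V \<Longrightarrow> w \<in> V \<Longrightarrow> B (u + v) w = B u w + B v w"
    and scale_left: "u \<in> V \<Longrightarrow> v \<in> V \<Longrightarrow> B (r *\<^sub>R u) v = r * B u v"
    and nonneg: "u \<in> V \<Longrightarrow> 0 \<le> B u u"
begin

lemma add_right: "u \<in> V \<Longrightarrow> v \<in> V \<Longrightarrow> w \<in> V \<Longrightarrow> B w (u + v) = B w u + B w v"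
  by (metis add_left sym subspace_V subspace_add)

lemma scale_right: "u \<in> V \<Longrightarrow> v \<in> V \<Longrightarrow> B v (r *\<^sub>R u) = r * B v u"
  by (metis scale_left sym subspace_V subspace_scale)

lemma diff_left: "u \<in> V \<Longrightarrow> v \<in> V \<Longrightarrow> w \<in> V \<Longrightarrow> B (u - v) w = B u w - B v w"
  by (metis add_left add_diff_cancel diff_add_cancel subspace_V subspace_diff)

lemma diff_right: "u \<in> V \<Longrightarrow> v \<in> V \<Longrightarrow> w \<in> V \<Longrightarrow> B w (u - v) = B w u - B w v"
  by (metis diff_left sym subspace_V subspace_diff)

lemmas mem_V = subspace_V[THEN subspace_add] subspace_V[THEN subspace_diff]
  subspace_V[THEN subspace_scale]

lemmas bilinear = add_left add_right diff_left diff_right scale_left scale_right mem_V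

lemma quadratic_expand:
  assumes "x \<in> V" "y \<in> V"
  shows "B (x - t *\<^sub>R y) (x - t *\<^sub>R y) = B x x - 2 * t * B x y + t\<^sup>2 * B y y"
  using assms sym[of y x] by (simp add: bilinear algebra_simps power2_eq_square)

lemma Cauchy_Schwarz:
  assumes "x \<in> V" "y \<in> V"
  shows "(B x y)\<^sup>2 \<le> B x x * B y y"
  using nonneg[OF assms(2)]
proof (rule nonneg_quadratic_imp_discriminant_le)
  fix t :: real
  have "0 \<le> B (x - t *\<^sub>R y) (x - t *\<^sub>R y)"
    using assms by (simp add: nonneg mem_V)
  then show "0 \<le> B x x - 2 * t * B x y + t\<^sup>2 * B y y"
    using assms by (simp add: quadratic_expand)
qed

text \<open>The parallelogram law for \<open>u - x\<close> and \<open>u - y\<close>, with the midpoint of \<open>x\<close> and \<open>y\<close> made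
  visible: it makes minimizing sequences in a subspace Cauchy.\<close>

lemma midpoint_identity:
  assumes "u \<in> V" "x \<in> V" "y \<in> V"
  shows "B (x - y) (x - y) =
    2 * B (u - x) (u - x) + 2 * B (u - y) (u - y)
      - 4 * B (u - (1/2) *\<^sub>R (x + y)) (u - (1/2) *\<^sub>R (x + y))"
  using assms sym[of x u] sym[of y u] sym[of y x]
  by (simp add: bilinear algebra_simps)

text \<open>Completeness is demanded of \<open>K\<close> only, in the seminorm of \<open>B\<close>. A minimizing sequence \<open>s\<close> for
  the distance from \<open>u\<close> to \<open>K\<close> is Cauchy. That \<open>s n\<close> minimizes up to \<open>1 / (n + 1)\<close> says that
  a quadratic polynomial in the coefficient of a direction \<open>m\<close> is nonnegative, and its discriminant
  bounds \<open>B (u - s n) m\<close> directly; so the limit satisfies the orthogonality relation without being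
  shown to be a minimizer beforehand.\<close>

lemma ex_orthogonal_approximant:
  assumes K: "subspace K" "K \<subseteq> V" and u: "u \<in> V"
    and complete: "\<And>s. (\<forall>n::nat. s n \<in> K) \<Longrightarrow>
        (\<forall>e>0. \<exists>N. \<forall>m\<ge>N. \<forall>n\<ge>N. B (s m - s n) (s m - s n) < e) \<Longrightarrow>
        \<exists>k\<in>K. (\<lambda>n. B (s n - k) (s n - k)) \<longlonglongrightarrow> 0"
  shows "\<exists>k\<in>K. \<forall>m\<in>K. B (u - k) m = 0"
proof -
  let ?Q = "\<lambda>x. B x x"
  define d where "d = (INF k\<in>K. ?Q (u - k))"
  have KV: "k \<in> V" if "k \<in> K" for k using that K by blast
  have K0: "0 \<in> K" using K(1) by (rule subspace_0)
  have bdd: "bdd_below ((\<lambda>k. ?Q (u - k)) ` K)"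
    by (rule bdd_belowI[of _ 0]) (auto simp: nonneg mem_V u KV)
  have d_le: "d \<le> ?Q (u - k)" if "k \<in> K" for k
    unfolding d_def by (rule cINF_lower[OF bdd that])
  have "\<exists>k\<in>K. ?Q (u - k) < d + inverse (real (Suc n))" for n
  proof -
    have "d < d + inverse (real (Suc n))" by simp
    then show ?thesis
      unfolding d_def using K0 by (subst (asm) cINF_less_iff[OF _ bdd]) auto
  qed
  then obtain s where sK: "\<And>n. s n \<in> K"
    and s: "\<And>n. ?Q (u - s n) < d + inverse (real (Suc n))"
    by metis
  note sV = KV[OF sK]
  have close: "?Q (s m - s n) < 2 * inverse (real (Suc m)) + 2 * inverse (real (Suc n))" for m n
  proof -
    have "d \<le> ?Q (u - (1/2) *\<^sub>R (s m + s n))"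
      by (intro d_le subspace_scale[OF K(1)] subspace_add[OF K(1)] sK)
    then show ?thesis
      using midpoint_identity[OF u sV sV, of m n] s[of m] s[of n] by linarith
  qed
  have "\<forall>e>0. \<exists>N. \<forall>m\<ge>N. \<forall>n\<ge>N. ?Q (s m - s n) < e"
  proof (intro allI impI)
    fix e :: real
    assume "0 < e"
    then obtain N where N: "inverse (real (Suc N)) < e / 4"
      using reals_Archimedean[of "e / 4"] by auto
    have "inverse (real (Suc m)) \<le> inverse (real (Suc N))" if "N \<le> m" for m
      using that by (simp add: field_simps)
    note small = order.strict_trans1[OF this N]
    have "?Q (s m - s n) < e" if "N \<le> m" "N \<le> n" for m n
      using close[of m n] small[OF that(1)] small[OF that(2)] by linarith
    then show "\<exists>N. \<forall>m\<ge>N. \<forall>n\<ge>N. ?Q (s m - s n) < e" by blast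
  qed
  then obtain k where k: "k \<in> K" and lim: "(\<lambda>n. ?Q (s n - k)) \<longlonglongrightarrow> 0"
    using complete[of s] sK by blast
  have "B (u - k) m = 0" if m: "m \<in> K" for m
  proof -
    note mV = KV[OF m]
    have usV: "u - s n \<in> V" for n by (intro mem_V u sV)
    have "(B (u - s n) m)\<^sup>2 \<le> inverse (real (Suc n)) * ?Q m" for n
      using nonneg[OF mV]
    proof (rule nonneg_quadratic_imp_discriminant_le)
      fix t :: real
      have "d \<le> ?Q (u - (s n + t *\<^sub>R m))"
        by (intro d_le subspace_add[OF K(1)] subspace_scale[OF K(1)] sK m)
      also have "u - (s n + t *\<^sub>R m) = (u - s n) - t *\<^sub>R m" by simp
      finally show "0 \<le> inverse (real (Suc n)) - 2 * t * B (u - s n) m + t\<^sup>2 * ?Q m"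
        using s[of n] by (simp add: quadratic_expand[OF usV mV])
    qed
    moreover have "(\<lambda>n. inverse (real (Suc n)) * ?Q m) \<longlonglongrightarrow> 0"
      using tendsto_mult_right[OF LIMSEQ_inverse_real_of_nat] by fastforce
    ultimately have lim1: "(\<lambda>n. B (u - s n) m) \<longlonglongrightarrow> 0"
      by (rule null_sequence_if_square_le)
    have "(B (s n - k) m)\<^sup>2 \<le> ?Q (s n - k) * ?Q m" for n
      by (intro Cauchy_Schwarz mem_V sV KV[OF k] mV)
    moreover have "(\<lambda>n. ?Q (s n - k) * ?Q m) \<longlonglongrightarrow> 0"
      using tendsto_mult_right[OF lim] by fastforce
    ultimately have lim2: "(\<lambda>n. B (s n - k) m) \<longlonglongrightarrow> 0"
      by (rule null_sequence_if_square_le)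
    have "B (u - s n) m + B (s n - k) m = B (u - k) m" for n
      by (simp add: diff_left u sV KV[OF k] mV)
    then show ?thesis
      using tendsto_add[OF lim1 lim2] by (simp add: LIMSEQ_const_iff)
  qed
  with k show ?thesis by blast
qed

end

section \<open>Conjugation and real part\<close>

lemma conjg_0 [simp]: "conjg 0 = (0::'k::real_or_complex)"
  using conjg_add[of "0::'k" 0] by simp

lemma conjg_of_real [simp]: "conjg (of_real r) = (of_real r :: 'k::real_or_complex)"
proof (cases "r = 0")
  case False
  have "of_real r * conjg (of_real r) = (of_real r * of_real r :: 'k)"
    using mult_conjg[of "of_real r :: 'k"] by (simp add: scaleR_conv_of_real power2_eq_square)
  then show ?thesis using False by simp
qed simp

lemma of_real_re_part: "of_real (2 * re_part x) = x + conjg (x::'k::real_or_complex)"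
  by (simp add: add_conjg scaleR_conv_of_real)

lemma re_part_eqI:
  fixes x :: "'k::real_or_complex"
  assumes "x + conjg x = of_real (2 * r)"
  shows "re_part x = r"
  using assms of_real_re_part[of x] by (metis mult_cancel_left of_real_eq_iff zero_neq_numeral)

lemma re_part_0 [simp]: "re_part (0::'k::real_or_complex) = 0"
  by (rule re_part_eqI) simp

lemma re_part_add [simp]: "re_part (x + y :: 'k::real_or_complex) = re_part x + re_part y"
proof (rule re_part_eqI)
  have "of_real (2 * (re_part x + re_part y)) = (x + conjg x) + (y + conjg y)"
    by (simp only: distrib_left of_real_add of_real_re_part)
  then show "x + y + conjg (x + y) = of_real (2 * (re_part x + re_part y))"
    by (simp add: conjg_add)
qed

lemma re_part_conjg [simp]: "re_part (conjg x :: 'k::real_or_complex) = re_part x"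
  by (rule re_part_eqI) (simp only: of_real_re_part conjg_conjg add.commute)

lemma re_part_of_real_mult [simp]:
  "re_part (of_real r * x :: 'k::real_or_complex) = r * re_part x"
proof (rule re_part_eqI)
  have "of_real (2 * (r * re_part x)) = of_real r * (x + conjg x)"
    unfolding of_real_re_part[symmetric] by simp
  then show "of_real r * x + conjg (of_real r * x) = of_real (2 * (r * re_part x))"
    by (simp add: conjg_mult distrib_left)
qed

lemma re_part_conjg_mult_self: "re_part (conjg x * x :: 'k::real_or_complex) = (norm x)\<^sup>2"
proof (rule re_part_eqI)
  have "conjg x * x = of_real ((norm x)\<^sup>2)"
    by (simp add: mult.commute[of "conjg x"] mult_conjg scaleR_conv_of_real)
  then show "conjg x * x + conjg (conjg x * x) = of_real (2 * (norm x)\<^sup>2)"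
    by (simp only: conjg_of_real mult_2 of_real_add)
qed

section \<open>The shifted form and the projection\<close>

locale form_with_operator = hilbert_space smul ip
  for smul :: "'k::real_or_complex \<Rightarrow> 'h::{real_inner,complete_space} \<Rightarrow> 'h"
    and ip :: "'h \<Rightarrow> 'h \<Rightarrow> 'k" +
  fixes smul' :: "'k \<Rightarrow> 'g::real_normed_vector \<Rightarrow> 'g"
    and D A :: "'h set"
    and E :: "'h \<Rightarrow> 'h \<Rightarrow> 'k"
    and J :: "'h \<Rightarrow> 'g"
  assumes codomain: "vector_space smul'"
    and positive: "positive_form smul D E"
    and closed: "closed_form D E"
    and A_D: "A \<subseteq> D"
    and linear_J: "linear_operator_on smul smul' A J"
    and closed_J: "closed_operator D (shifted_form ip E 1) A J"
begin

abbreviation F :: "real \<Rightarrow> 'h \<Rightarrow> 'h \<Rightarrow> 'k" where "F \<equiv> shifted_form ip E"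
abbreviation Ker :: "'h set" where "Ker \<equiv> op_kernel A J"
abbreviation P :: "real \<Rightarrow> 'h \<Rightarrow> 'h" where "P \<equiv> proj_P ip D E A J"

lemma subspace_imp_real_subspace:
  assumes "module.subspace smul S"
  shows "real_vector.subspace S"
  using assms
  unfolding real_vector.subspace_def subspace_def smul_of_real[symmetric] by blast

lemma subspace_D: "real_vector.subspace D"
  using positive unfolding positive_form_def by (blast intro: subspace_imp_real_subspace)

lemma subspace_A: "real_vector.subspace A"
  using linear_J unfolding linear_operator_on_def by (blast intro: subspace_imp_real_subspace)

lemma J_add: "u \<in> A \<Longrightarrow> v \<in> A \<Longrightarrow> J (u + v) = J u + J v"
  using linear_J unfolding linear_operator_on_def by blast

lemma J_smul: "u \<in> A \<Longrightarrow> J (smul c u) = smul' c (J u)"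
  using linear_J unfolding linear_operator_on_def by blast

lemma J_diff: "u \<in> A \<Longrightarrow> v \<in> A \<Longrightarrow> J (u - v) = J u - J v"
  by (metis J_add add_diff_cancel diff_add_cancel subspace_A real_vector.subspace_diff)

lemma Ker_smul: "k \<in> Ker \<Longrightarrow> smul c k \<in> Ker"
proof -
  interpret G: vector_space smul' by (rule codomain)
  assume "k \<in> Ker"
  moreover have "subspace A" using linear_J unfolding linear_operator_on_def by blast
  ultimately show ?thesis
    by (auto simp: op_kernel_def J_smul subspace_scale)
qed

lemma subspace_Ker: "real_vector.subspace Ker"
proof -
  have "0 \<in> A" by (rule real_vector.subspace_0[OF subspace_A])
  moreover from this have "J 0 = 0" using J_add[of 0 0] by simp
  moreover have "r *\<^sub>R k \<in> Ker" if "k \<in> Ker" for r k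
    using Ker_smul[OF that, of "of_real r"] by (simp add: smul_of_real)
  ultimately show ?thesis
    unfolding real_vector.subspace_def
    by (auto simp: op_kernel_def J_add real_vector.subspace_add[OF subspace_A])
qed

lemma Ker_D: "k \<in> Ker \<Longrightarrow> k \<in> D"
  using A_D by (auto simp: op_kernel_def)

lemma E_add_left: "u \<in> D \<Longrightarrow> v \<in> D \<Longrightarrow> w \<in> D \<Longrightarrow> E (u + v) w = E u w + E v w"
  using positive unfolding positive_form_def sesquilinear_on_def by blast

lemma E_smul_left: "u \<in> D \<Longrightarrow> v \<in> D \<Longrightarrow> E (smul c u) v = c * E u v"
  using positive unfolding positive_form_def sesquilinear_on_def by blast

lemma F_add_left: "u \<in> D \<Longrightarrow> v \<in> D \<Longrightarrow> w \<in> D \<Longrightarrow> F l (u + v) w = F l u w + F l v w"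
  by (simp add: shifted_form_def E_add_left ip_add_left algebra_simps)

lemma F_smul_left: "u \<in> D \<Longrightarrow> v \<in> D \<Longrightarrow> F l (smul c u) v = c * F l u v"
  by (simp add: shifted_form_def E_smul_left ip_smul_left algebra_simps)

lemma F_sym: "u \<in> D \<Longrightarrow> v \<in> D \<Longrightarrow> F l v u = conjg (F l u v)"
proof -
  assume "u \<in> D" "v \<in> D"
  then have "E v u = conjg (E u v)" using positive unfolding positive_form_def by blast
  then show ?thesis
    by (simp add: shifted_form_def conjg_add conjg_mult ip_sym[of v u])
qed

lemma F_diff_left: "u \<in> D \<Longrightarrow> v \<in> D \<Longrightarrow> w \<in> D \<Longrightarrow> F l (u - v) w = F l u w - F l v w"
  by (metis F_add_left add_diff_cancel diff_add_cancel subspace_D real_vector.subspace_diff)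

lemma F_commute_zero: "u \<in> D \<Longrightarrow> v \<in> D \<Longrightarrow> F l u v = 0 \<Longrightarrow> F l v u = 0"
  by (simp add: F_sym[of u v])

lemma qform_F: "qform (F l) u = qform E u + l * (norm u)\<^sup>2"
  by (simp add: qform_def shifted_form_def re_ip power2_norm_eq_inner)

lemma qform_E_nonneg: "u \<in> D \<Longrightarrow> 0 \<le> qform E u"
  using positive unfolding positive_form_def by blast

lemma qform_F_mono: "l \<le> m \<Longrightarrow> qform (F l) u \<le> qform (F m) u"
  by (simp add: qform_F mult_right_mono)

lemma F_definite:
  assumes "0 < l" "u \<in> D" "F l u u = 0"
  shows "u = 0"
proof -
  have "qform E u + l * (norm u)\<^sup>2 = 0"
    using assms(3) qform_F[of l u] by (simp add: qform_def)
  with qform_E_nonneg[OF assms(2)] assms(1) have "l * (norm u)\<^sup>2 \<le> 0" by linarith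
  then show ?thesis using assms(1) by (simp add: mult_le_0_iff)
qed

lemma nonneg_form_re_F:
  assumes "0 < l"
  shows "nonneg_form D (\<lambda>u v. re_part (F l u v))"
proof
  show "real_vector.subspace D" by (rule subspace_D)
next
  fix u v assume "u \<in> D" "v \<in> D"
  then show "re_part (F l u v) = re_part (F l v u)" by (simp add: F_sym[of u v])
next
  fix u v w assume "u \<in> D" "v \<in> D" "w \<in> D"
  then show "re_part (F l (u + v) w) = re_part (F l u w) + re_part (F l v w)"
    by (simp add: F_add_left)
next
  fix u v r assume "u \<in> D" "v \<in> D"
  then show "re_part (F l (r *\<^sub>R u) v) = r * re_part (F l u v)"
    by (simp add: F_smul_left smul_of_real[symmetric])
next
  fix u assume "u \<in> D"
  then show "0 \<le> re_part (F l u u)"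
    using qform_F[of l u] qform_E_nonneg[of u] assms by (simp add: qform_def)
qed

text \<open>Since \<open>\<E>\<^sub>\<lambda>\<close> controls both the norm and \<open>\<E>\<close>, a Cauchy sequence converges in the ambient
  Hilbert space, hence with respect to \<open>\<E>\<close> because the form is closed; closedness of \<open>J\<close> keeps the
  limit in the kernel. Convergence is obtained for the norm and for \<open>\<E>\<close> separately, hence for every
  shift at once: closedness of \<open>J\<close> needs it for the shift \<open>1\<close>, the conclusion for \<open>\<lambda>\<close>.\<close>

lemma Ker_complete:
  assumes l: "0 < l" and s: "\<And>n. s n \<in> Ker"
    and Cauchy_F: "\<And>e. 0 < e \<Longrightarrow> \<exists>N. \<forall>m\<ge>N. \<forall>n\<ge>N. qform (F l) (s m - s n) < e"
  shows "\<exists>k\<in>Ker. (\<lambda>n. qform (F l) (s n - k)) \<longlonglongrightarrow> 0"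
proof -
  have sD: "s n \<in> D" for n using s by (rule Ker_D)
  have diffD: "s m - s n \<in> D" for m n
    by (intro real_vector.subspace_diff[OF subspace_D] sD)
  have "Cauchy s"
    unfolding Cauchy_def
  proof (intro allI impI)
    fix e :: real assume e: "0 < e"
    then obtain N where N: "\<forall>m\<ge>N. \<forall>n\<ge>N. qform (F l) (s m - s n) < l * e\<^sup>2"
      using Cauchy_F[of "l * e\<^sup>2"] l by auto
    have "dist (s m) (s n) < e" if "N \<le> m" "N \<le> n" for m n
    proof -
      have "l * (norm (s m - s n))\<^sup>2 < l * e\<^sup>2"
        using N that qform_F[of l "s m - s n"] qform_E_nonneg[OF diffD, of m n] by force
      then have "(norm (s m - s n))\<^sup>2 < e\<^sup>2" using l by simp
      then show ?thesis
        using e by (simp add: dist_norm power2_less_imp_less)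
    qed
    then show "\<exists>N. \<forall>m\<ge>N. \<forall>n\<ge>N. dist (s m) (s n) < e" by blast
  qed
  then obtain k where lim: "s \<longlonglongrightarrow> k"
    using Cauchy_convergent convergent_def by blast
  have "qform E x \<le> qform (F l) x" for x using l by (simp add: qform_F)
  then have "\<forall>e>0. \<exists>N. \<forall>m\<ge>N. \<forall>n\<ge>N. qform E (s m - s n) < e"
    using Cauchy_F by (meson order_le_less_trans)
  with closed lim sD have kD: "k \<in> D" and E_lim: "(\<lambda>n. qform E (s n - k)) \<longlonglongrightarrow> 0"
    unfolding closed_form_def by blast+
  have F_lim: "(\<lambda>n. qform (F m) (s n - k)) \<longlonglongrightarrow> 0" for m
  proof -
    have "(\<lambda>n. norm (s n - k)) \<longlonglongrightarrow> 0"
      using lim by (simp add: LIM_zero tendsto_norm_zero)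
    then have "(\<lambda>n. m * (norm (s n - k))\<^sup>2) \<longlonglongrightarrow> m * 0\<^sup>2"
      by (intro tendsto_intros)
    from tendsto_add[OF E_lim this] show ?thesis by (simp add: qform_F)
  qed
  have "(\<lambda>n. sqrt (qform (F 1) (s n - k))) \<longlonglongrightarrow> 0"
    using tendsto_real_sqrt[OF F_lim[of 1]] by simp
  moreover have "(\<lambda>n. J (s n)) \<longlonglongrightarrow> 0" "\<forall>n. s n \<in> A"
    using s by (auto simp: op_kernel_def)
  ultimately have "k \<in> A \<and> J k = 0"
    using closed_J kD unfolding closed_operator_def by blast
  then show ?thesis using F_lim by (auto simp: op_kernel_def)
qed

lemma ex_orthogonal_decomposition:
  assumes l: "0 < l" and u: "u \<in> D"
  shows "\<exists>k\<in>Ker. u - k \<in> orth_compl D (F l) Ker"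
proof -
  interpret B: nonneg_form D "\<lambda>u v. re_part (F l u v)"
    using l by (rule nonneg_form_re_F)
  obtain k where k: "k \<in> Ker" and orth: "\<And>m. m \<in> Ker \<Longrightarrow> re_part (F l (u - k) m) = 0"
    using B.ex_orthogonal_approximant[OF subspace_Ker _ u] Ker_complete[OF l] Ker_D
    unfolding qform_def by blast
  have uk: "u - k \<in> D" using u Ker_D[OF k] by (rule real_vector.subspace_diff[OF subspace_D])
  have "F l (u - k) m = 0" if m: "m \<in> Ker" for m
  proof -
    \<comment> \<open>Rotating \<open>m\<close> by the scalar \<open>F l (u - k) m\<close> turns the real part into the squared modulus.\<close>
    let ?c = "F l (u - k) m"
    have "F l (u - k) (smul ?c m) = conjg (F l (smul ?c m) (u - k))"
      using F_sym[OF Ker_D[OF Ker_smul[OF m]] uk] .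
    also have "\<dots> = conjg ?c * conjg (F l m (u - k))"
      by (simp add: F_smul_left[OF Ker_D[OF m] uk] conjg_mult)
    also have "\<dots> = conjg ?c * ?c"
      by (simp add: F_sym[OF Ker_D[OF m] uk])
    finally have "(norm ?c)\<^sup>2 = 0"
      using orth[OF Ker_smul[OF m, of ?c]] by (simp add: re_part_conjg_mult_self)
    then show ?thesis by simp
  qed
  with k uk show ?thesis by (auto simp: orth_compl_def)
qed

text \<open>The definite description that defines the projection selects the summand found above: its
  complement \<open>k\<close> in the kernel is orthogonal to the whole orthogonal complement, and two candidates
  would differ by a vector orthogonal to itself.\<close>

lemma P_decomposition:
  assumes l: "0 < l" and u: "u \<in> D"
  shows "u - P l u \<in> Ker" and "P l u \<in> orth_compl D (F l) Ker"
proof -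
  let ?M = "orth_compl D (F l) Ker"
  obtain k where k: "k \<in> Ker" and uk: "u - k \<in> ?M"
    using ex_orthogonal_decomposition[OF l u] by blast
  note kD = Ker_D[OF k]
  have MD: "w \<in> D" if "w \<in> ?M" for w using that by (simp add: orth_compl_def)
  have k_orth: "F l k m = 0" if "m \<in> ?M" for m
    using F_commute_zero[OF MD[OF that] kD] that k by (simp add: orth_compl_def)
  have "P l u = u - k"
    unfolding proj_P_def orth_proj_def
  proof (rule the_equality)
    show "u - k \<in> ?M \<and> (\<forall>m\<in>?M. F l (u - (u - k)) m = 0)"
      using uk k_orth by simp
  next
    fix w assume w: "w \<in> ?M \<and> (\<forall>m\<in>?M. F l (u - w) m = 0)"
    define x where "x = w - (u - k)"
    have wD: "w \<in> D" using w MD by blast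
    have "x \<in> D"
      unfolding x_def using wD MD[OF uk] by (rule real_vector.subspace_diff[OF subspace_D])
    moreover have "F l x s = 0" if s: "s \<in> Ker" for s
      using w uk s unfolding x_def F_diff_left[OF wD MD[OF uk] Ker_D[OF s]]
      by (simp add: orth_compl_def)
    ultimately have xM: "x \<in> ?M" by (simp add: orth_compl_def)
    have "u - w \<in> D" using u wD by (rule real_vector.subspace_diff[OF subspace_D])
    then have "F l (k - (u - w)) x = 0"
      using k_orth[OF xM] w xM by (simp add: F_diff_left kD MD)
    then have "F l x x = 0" by (simp add: x_def algebra_simps)
    then show "w = u - k" using F_definite[OF l MD[OF xM]] by (simp add: x_def)
  qed
  then show "u - P l u \<in> Ker" and "P l u \<in> ?M" using k uk by simp_all
qed

lemma P_competitor:
  assumes "0 < l" "u \<in> A"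
  shows "P l u \<in> A" and "J (P l u) = J u"
proof -
  have uD: "u \<in> D" using assms A_D by blast
  have k: "u - P l u \<in> A" "J (u - P l u) = 0"
    using P_decomposition(1)[OF assms(1) uD] by (auto simp: op_kernel_def)
  have "u - (u - P l u) \<in> A" using assms(2) k(1) by (rule real_vector.subspace_diff[OF subspace_A])
  then show "P l u \<in> A" by simp
  then show "J (P l u) = J u" using k J_diff[OF assms(2)] by simp
qed

text \<open>Pythagoras: \<open>v - P l u\<close> lies in the kernel, to which \<open>P l u\<close> is orthogonal.\<close>

lemma P_minimizes:
  assumes l: "0 < l" and u: "u \<in> A" and v: "v \<in> A" "J v = J u"
  shows "qform (F l) (P l u) \<le> qform (F l) v"
proof -
  interpret B: nonneg_form D "\<lambda>u v. re_part (F l u v)"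
    using l by (rule nonneg_form_re_F)
  define k where "k = v - P l u"
  have k: "k \<in> Ker"
    using P_competitor[OF l u] v
    by (simp add: k_def op_kernel_def J_diff real_vector.subspace_diff[OF subspace_A])
  have Pu: "P l u \<in> D" "F l (P l u) k = 0"
    using P_decomposition(2)[OF l] u A_D k unfolding orth_compl_def by blast+
  have "qform (F l) v = qform (F l) (P l u - (-1) *\<^sub>R k)" by (simp add: k_def)
  also have "\<dots> = qform (F l) (P l u) + qform (F l) k"
    unfolding qform_def B.quadratic_expand[OF Pu(1) Ker_D[OF k]] by (simp add: Pu(2))
  finally show ?thesis using B.nonneg[OF Ker_D[OF k]] by (simp add: qform_def)
qed

text \<open>A minimum is determined by its problem, and the problem depends on \<open>u\<close> through \<open>J u\<close> only;
  this makes the description defining the form on the range of \<open>J\<close> definite.\<close>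

lemma check_form_eq:
  assumes l: "0 < l" and u: "u \<in> A"
  shows "check_form ip D E A J l (J u) = qform (F l) (P l u)"
  unfolding check_form_def
proof (rule the_equality)
  show "\<exists>u'\<in>A. J u' = J u \<and> qform (F l) (P l u) = qform (F l) (P l u')"
    using u by blast
next
  fix e assume "\<exists>u'\<in>A. J u' = J u \<and> e = qform (F l) (P l u')"
  then obtain u' where u': "u' \<in> A" "J u' = J u" "e = qform (F l) (P l u')" by blast
  have "qform (F l) (P l u) \<le> e"
    using P_minimizes[OF l u] P_competitor[OF l u'(1)] u' by simp
  moreover have "e \<le> qform (F l) (P l u)"
    using P_minimizes[OF l u'(1)] P_competitor[OF l u] u' by simp
  ultimately show "e = qform (F l) (P l u)" by simp
qed

theorem Dirichlet_principle:
  assumes l: "0 < l" and u: "u \<in> A"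
  shows "check_form ip D E A J l (J u) = Inf {qform (F l) v | v. v \<in> A \<and> J v = J u}"
  unfolding check_form_eq[OF l u]
  using P_competitor[OF l u] P_minimizes[OF l u]
  by (intro cInf_eq_minimum[symmetric]) blast+

theorem check_form_mono:
  assumes l: "0 < l" "l \<le> m" and u: "u \<in> A"
  shows "check_form ip D E A J l (J u) \<le> check_form ip D E A J m (J u)"
proof -
  have m: "0 < m" using l by simp
  have "qform (F l) (P l u) \<le> qform (F l) (P m u)"
    by (intro P_minimizes l u P_competitor[OF m u])
  also have "\<dots> \<le> qform (F m) (P m u)" by (rule qform_F_mono[OF l(2)])
  finally show ?thesis by (simp add: check_form_eq l(1) m u)
qed

end

section \<open>The Dirichlet principle\<close>

theorem theorem2p1:
  fixes scaleH :: "'k::real_or_complex \<Rightarrow> 'h::{real_inner,complete_space} \<Rightarrow> 'h"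
    and ipH :: "'h \<Rightarrow> 'h \<Rightarrow> 'k"
    and scaleG :: "'k \<Rightarrow> 'g::{real_inner,complete_space} \<Rightarrow> 'g"
    and ipG :: "'g \<Rightarrow> 'g \<Rightarrow> 'k"
    and D domJ :: "'h set"
    and E :: "'h \<Rightarrow> 'h \<Rightarrow> 'k"
    and J :: "'h \<Rightarrow> 'g"
  assumes "hilbert_space scaleH ipH"
    and "hilbert_space scaleG ipG"
    and "positive_form scaleH D E"
    and "closed_form D E"
    and "domJ \<subseteq> D"
    and "linear_operator_on scaleH scaleG domJ J"
    and "closure (J ` domJ) = UNIV"
    and "closed_operator D (shifted_form ipH E 1) domJ J"
  shows "(\<forall>l>0. \<forall>u\<in>domJ.
            check_form ipH D E domJ J l (J u) =
              Inf {qform (shifted_form ipH E l) v | v. v \<in> domJ \<and> J v = J u}) \<and>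
         (\<forall>l m. 0 < l \<and> l \<le> m \<longrightarrow>
            (\<forall>\<psi>\<in>J ` domJ. check_form ipH D E domJ J l \<psi> \<le> check_form ipH D E domJ J m \<psi>))"
proof -
  interpret G: hilbert_space scaleG ipG by fact
  interpret form_with_operator scaleH ipH scaleG D domJ E J
    by (intro form_with_operator.intro form_with_operator_axioms.intro assms
        G.vector_space_axioms)
  show ?thesis using Dirichlet_principle check_form_mono by blast
qed

end
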